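(* Let $2\le m\le n$ be integers. Then $d_g(K_{m,n})=\frac{m}{2}$ if $m$ and $n$ are both even, and $d_g(K_{m,n})=\lceil\frac{m+1}{2}\rceil$ otherwise. Moreover, $d_g'(K_{m,n})=\frac{m}{2}$ if $m$ is even and $n$ is odd, and $d_g'(K_{m,n})=\lceil\frac{m+1}{2}\rceil$ otherwise.
   Context: $K_{m,n}$ denotes the complete bipartite graph with parts of sizes $m$ and $n$. For a vertex $x$, $N[x]$ denotes its closed neighborhood. The domatic number game on a graph $G$ with palette $[k]=\{1,\dots,k\}$: two players, Alice and Bob, alternately choose a previously unchosen vertex of $G$ and assign it a color from $[k]$, until every vertex has been colored. Let $V_i$ be the set of vertices colored $i$. Alice wins if every $V_i$ ($i\in[k]$) is a dominating set of $G$, i.e. for every vertex $x$ and every color $c\in[k]$ some vertex of $N[x]$ has color $c$; otherwise Bob wins. In the $A$-game Alice moves first; in the $B$-game Bob moves first. The game domatic number $d_g(G)$ is the largest $k$ for which Alice has a winning strategy in the $A$-game with palette $[k]$, and the delayed game domatic number $d_g'(G)$ is the largest $k$ for which Alice has a winning strategy in the $B$-game with palette $[k]$. *)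

theory Defs
  imports Complex_Main "Graph_Theory.Kuratowski"
begin

text \<open>Simple graphs are the symmetric digraphs of the locale \<open>graph\<close>, as in the library's
  \<open>complete_bipartite_digraph\<close>.\<close>

definition closed_neighborhood :: "('a, 'b) pre_digraph \<Rightarrow> 'a \<Rightarrow> 'a set" where
  "closed_neighborhood G x = insert x {y. x \<rightarrow>\<^bsub>G\<^esub> y}"

definition dominating_set :: "('a, 'b) pre_digraph \<Rightarrow> 'a set \<Rightarrow> bool" where
  "dominating_set G D \<longleftrightarrow>
    D \<subseteq> verts G \<and> (\<forall>x \<in> verts G. closed_neighborhood G x \<inter> D \<noteq> {})"

datatype player = Alice | Bob

text \<open>A history lists the moves made so far in chronological order; the move \<open>(v, c)\<close> gives the
  vertex \<open>v\<close> the color \<open>c\<close>.\<close>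

type_synonym 'a history = "('a \<times> nat) list"

definition legal_history :: "('a, 'b) pre_digraph \<Rightarrow> nat \<Rightarrow> 'a history \<Rightarrow> bool" where
  "legal_history G k h \<longleftrightarrow>
    distinct (map fst h) \<and> fst ` set h \<subseteq> verts G \<and> snd ` set h \<subseteq> {1..k}"

definition complete_history :: "('a, 'b) pre_digraph \<Rightarrow> 'a history \<Rightarrow> bool" where
  "complete_history G h \<longleftrightarrow> fst ` set h = verts G"

definition color_class :: "'a history \<Rightarrow> nat \<Rightarrow> 'a set" where
  "color_class h c = {v. (v, c) \<in> set h}"

definition alice_wins :: "('a, 'b) pre_digraph \<Rightarrow> nat \<Rightarrow> 'a history \<Rightarrow> bool" where
  "alice_wins G k h \<longleftrightarrow> (\<forall>c \<in> {1..k}. dominating_set G (color_class h c))"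

text \<open>\<open>alice_to_move p i\<close>: if player \<open>p\<close> starts, it is Alice's turn after \<open>i\<close> moves.\<close>

definition alice_to_move :: "player \<Rightarrow> nat \<Rightarrow> bool" where
  "alice_to_move p i \<longleftrightarrow> (if p = Alice then even i else odd i)"

text \<open>A strategy for Alice maps each history to her next move.\<close>

type_synonym 'a strategy = "'a history \<Rightarrow> 'a \<times> nat"

definition legal_strategy ::
    "('a, 'b) pre_digraph \<Rightarrow> nat \<Rightarrow> player \<Rightarrow> 'a strategy \<Rightarrow> bool" where
  "legal_strategy G k p \<sigma> \<longleftrightarrow>
    (\<forall>h. legal_history G k h \<and> \<not> complete_history G h \<and> alice_to_move p (length h)
      \<longrightarrow> legal_history G k (h @ [\<sigma> h]))"

definition follows :: "player \<Rightarrow> 'a strategy \<Rightarrow> 'a history \<Rightarrow> bool" where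
  "follows p \<sigma> h \<longleftrightarrow> (\<forall>i < length h. alice_to_move p i \<longrightarrow> h ! i = \<sigma> (take i h))"

definition winning_strategy ::
    "('a, 'b) pre_digraph \<Rightarrow> nat \<Rightarrow> player \<Rightarrow> 'a strategy \<Rightarrow> bool" where
  "winning_strategy G k p \<sigma> \<longleftrightarrow> legal_strategy G k p \<sigma> \<and>
    (\<forall>h. legal_history G k h \<and> complete_history G h \<and> follows p \<sigma> h \<longrightarrow> alice_wins G k h)"

text \<open>The palette must be nonempty: for \<open>k = 0\<close> there are no moves, so that Bob would be stuck
  when he starts and every strategy of Alice would be vacuously winning.\<close>

definition game_domatic_number :: "('a, 'b) pre_digraph \<Rightarrow> nat" where
  "game_domatic_number G = (GREATEST k. 1 \<le> k \<and> (\<exists>\<sigma>. winning_strategy G k Alice \<sigma>))"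

definition delayed_game_domatic_number :: "('a, 'b) pre_digraph \<Rightarrow> nat" where
  "delayed_game_domatic_number G = (GREATEST k. 1 \<le> k \<and> (\<exists>\<sigma>. winning_strategy G k Bob \<sigma>))"

end

theory Submission
  imports Defs
begin

text \<open>On each side of the bipartition only two numbers matter: how many vertices are uncolored and
  how many colors occur. If the players alternate on a side and Bob only repeats colors there, then
  about half of the vertices receive a new color, with one bonus color if Bob has to open the side.
  Alice answers on the side Bob has just played, so the only danger for her is that Bob fills a side
  and thereby forces her to open the other one; parity decides whether this can happen. Conversely,
  Bob plays repeated colors on the smaller side, or, when \<open>m\<close> is even and parity is in his favor,
  answers on the side Alice has just played so that she must open the smaller side.\<close>

section \<open>Strategies from invariants\<close>

text \<open>Puts the two players on the same footing, so that one invariant principle serves Alice's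
  strategies and Bob's.\<close>

definition on_move :: "player \<Rightarrow> player \<Rightarrow> nat \<Rightarrow> bool" where
  "on_move p q i \<longleftrightarrow> alice_to_move p i = (q = Alice)"

lemma on_move_Suc [simp]: "on_move p q (Suc i) \<longleftrightarrow> \<not> on_move p q i"
  by (auto simp: on_move_def alice_to_move_def)

lemma on_move_0 [simp]: "on_move p q 0 \<longleftrightarrow> p = q"
  by (cases p; cases q) (auto simp: on_move_def alice_to_move_def)

text \<open>\<open>P\<close> marks positions inside which \<open>q\<close> can keep the play: every
  opposing move stays there, and \<open>q\<close> always has some move that does.\<close>

definition can_maintain ::
    "('a, 'b) pre_digraph \<Rightarrow> nat \<Rightarrow> player \<Rightarrow> player \<Rightarrow> ('a history \<Rightarrow> bool) \<Rightarrow> bool" where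
  "can_maintain G k p q P \<longleftrightarrow> P [] \<and>
    (\<forall>h x. legal_history G k (h @ [x]) \<and> P h \<and> \<not> on_move p q (length h) \<longrightarrow> P (h @ [x])) \<and>
    (\<forall>h. legal_history G k h \<and> P h \<and> \<not> complete_history G h \<and> on_move p q (length h) \<longrightarrow>
      (\<exists>x. legal_history G k (h @ [x]) \<and> P (h @ [x])))"

lemma legal_history_Nil [simp]: "legal_history G k []"
  by (simp add: legal_history_def)

lemma legal_history_snoc:
  "legal_history G k (h @ [(v, c)]) \<longleftrightarrow>
    legal_history G k h \<and> v \<in> verts G - fst ` set h \<and> c \<in> {1..k}"
  by (auto simp: legal_history_def)

lemma legal_history_snocD: "legal_history G k (h @ [x]) \<Longrightarrow> legal_history G k h"
  by (auto simp: legal_history_def)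

lemma legal_history_snoc_incomplete:
  "legal_history G k (h @ [x]) \<Longrightarrow> \<not> complete_history G h"
  by (cases x) (auto simp: legal_history_snoc complete_history_def)

text \<open>Reduces the task to whole rounds, an opposing move followed by a reply. The first
  alternative in \<open>round\<close> covers an opposing move that takes the last vertex, after
  which no reply exists.\<close>

lemma can_maintainI:
  assumes init: "if p = q then \<exists>x. legal_history G k [x] \<and> I [x] else I []"
    and round: "\<And>h x. \<lbrakk>legal_history G k (h @ [x]); I h\<rbrakk> \<Longrightarrow>
      complete_history G (h @ [x]) \<and> W (h @ [x]) \<or>
      (\<exists>y. legal_history G k (h @ [x, y]) \<and> I (h @ [x, y]))"
    and final: "\<And>h. \<lbrakk>legal_history G k h; complete_history G h; I h\<rbrakk> \<Longrightarrow> W h"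
  obtains P where "can_maintain G k p q P"
    and "\<And>h. \<lbrakk>legal_history G k h; complete_history G h; P h\<rbrakk> \<Longrightarrow> W h"
proof
  \<comment> \<open>\<open>I\<close> speaks about positions with the opponent to move. At the turn
    of \<open>q\<close>, the game must be over with outcome \<open>W\<close>, or some reply must
    restore \<open>I\<close>.\<close>
  define P where "P = (\<lambda>h. if on_move p q (length h)
    then complete_history G h \<and> W h \<or> (\<exists>x. legal_history G k (h @ [x]) \<and> I (h @ [x])) else I h)"
  show "can_maintain G k p q P"
    unfolding can_maintain_def
  proof (intro conjI allI impI)
    show "P []" using init by (auto simp: P_def)
    show "P (h @ [x])"
      if "legal_history G k (h @ [x]) \<and> P h \<and> \<not> on_move p q (length h)" for h x
      using that round[of h x] by (auto simp: P_def)
    show "\<exists>x. legal_history G k (h @ [x]) \<and> P (h @ [x])"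
      if "legal_history G k h \<and> P h \<and> \<not> complete_history G h \<and> on_move p q (length h)" for h
      using that by (auto simp: P_def)
  qed
  show "W h" if "legal_history G k h" "complete_history G h" "P h" for h
    using that final[of h] legal_history_snoc_incomplete[of G k h]
    by (auto simp: P_def split: if_splits)
qed

lemma follows_snoc:
  "follows p \<sigma> (h @ [x]) \<longleftrightarrow>
    follows p \<sigma> h \<and> (alice_to_move p (length h) \<longrightarrow> x = \<sigma> h)"
  by (auto simp: follows_def nth_append less_Suc_eq)

lemma ex_legal_move:
  assumes "1 \<le> k" "legal_history G k h" "\<not> complete_history G h"
  obtains x where "legal_history G k (h @ [x])"
proof -
  obtain v where "v \<in> verts G - fst ` set h"
    using assms by (auto simp: legal_history_def complete_history_def)
  then show ?thesis
    using assms that[of "(v, 1)"] by (simp add: legal_history_snoc)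
qed

lemma winning_strategyI:
  assumes "1 \<le> k" and keep: "can_maintain G k p Alice P"
    and win: "\<And>h. \<lbrakk>legal_history G k h; complete_history G h; P h\<rbrakk> \<Longrightarrow> alice_wins G k h"
  shows "\<exists>\<sigma>. winning_strategy G k p \<sigma>"
proof -
  \<comment> \<open>\<open>legal_strategy\<close> asks for legal moves at all histories, also those
    violating \<open>P\<close>, hence the implication.\<close>
  define \<sigma> where "\<sigma> h = (SOME x. legal_history G k (h @ [x]) \<and> (P h \<longrightarrow> P (h @ [x])))" for h
  have \<sigma>: "legal_history G k (h @ [\<sigma> h]) \<and> (P h \<longrightarrow> P (h @ [\<sigma> h]))"
    if "legal_history G k h" "\<not> complete_history G h" "alice_to_move p (length h)" for h
  proof -
    obtain x where "legal_history G k (h @ [x])"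
      using ex_legal_move[OF assms(1) \<open>legal_history G k h\<close> \<open>\<not> complete_history G h\<close>] .
    moreover have "\<exists>x. legal_history G k (h @ [x]) \<and> P (h @ [x])" if "P h"
      using keep \<open>P h\<close> \<open>legal_history G k h\<close> \<open>\<not> complete_history G h\<close>
        \<open>alice_to_move p (length h)\<close> by (simp add: can_maintain_def on_move_def)
    ultimately have "\<exists>x. legal_history G k (h @ [x]) \<and> (P h \<longrightarrow> P (h @ [x]))" by blast
    then show ?thesis unfolding \<sigma>_def by (rule someI_ex)
  qed
  have "P h" if "legal_history G k h" "follows p \<sigma> h" for h
    using that
  proof (induction h rule: rev_induct)
    case Nil
    then show ?case using keep by (simp add: can_maintain_def)
  next
    case (snoc x h)
    have h: "legal_history G k h" "P h"
      using snoc legal_history_snocD follows_snoc by blast+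
    show ?case
    proof (cases "alice_to_move p (length h)")
      case True
      then show ?thesis
        using \<sigma>[of h] h snoc.prems legal_history_snoc_incomplete by (fastforce simp: follows_snoc)
    next
      case False
      then show ?thesis
        using keep h snoc.prems unfolding can_maintain_def on_move_def by blast
    qed
  qed
  then have "winning_strategy G k p \<sigma>"
    using \<sigma> win by (auto simp: winning_strategy_def legal_strategy_def)
  then show ?thesis by blast
qed

text \<open>Bob's moves are built against a fixed winning \<open>\<sigma>\<close>: a play that keeps
  \<open>P\<close> can never be complete, so it can always be prolonged, eventually beyond the
  number of vertices.\<close>

lemma not_winning_strategyI:
  assumes "finite (verts G)" and keep: "can_maintain G k p Bob P"
    and lose: "\<And>h. \<lbrakk>legal_history G k h; complete_history G h; P h\<rbrakk> \<Longrightarrow> \<not> alice_wins G k h"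
  shows "\<not> winning_strategy G k p \<sigma>"
proof
  assume \<sigma>: "winning_strategy G k p \<sigma>"
  let ?Q = "\<lambda>h. legal_history G k h \<and> follows p \<sigma> h \<and> P h"
  have incomplete: "\<not> complete_history G h" if "?Q h" for h
    using that \<sigma> lose by (auto simp: winning_strategy_def)
  have "\<exists>h. ?Q h \<and> length h = i" for i
  proof (induction i)
    case 0
    then show ?case using keep by (auto simp: can_maintain_def follows_def)
  next
    case (Suc i)
    then obtain h where h: "?Q h" "length h = i" by blast
    have "\<exists>x. ?Q (h @ [x])"
    proof (cases "alice_to_move p (length h)")
      case True
      then have "legal_history G k (h @ [\<sigma> h])"
        using \<sigma> h incomplete by (auto simp: winning_strategy_def legal_strategy_def)
      moreover from this have "P (h @ [\<sigma> h])"
        using True h keep unfolding can_maintain_def on_move_def by blast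
      ultimately have "?Q (h @ [\<sigma> h])" using h by (simp add: follows_snoc)
      then show ?thesis ..
    next
      case False
      then have "\<exists>x. legal_history G k (h @ [x]) \<and> P (h @ [x])"
        using h incomplete keep by (simp add: can_maintain_def on_move_def)
      then show ?thesis using False h by (auto simp: follows_snoc)
    qed
    then show ?case using h by fastforce
  qed
  then obtain h where h: "?Q h" "length h = Suc (card (verts G))" by blast
  then have "card (fst ` set h) = Suc (card (verts G))"
    by (metis distinct_card legal_history_def length_map list.set_map)
  moreover have "card (fst ` set h) \<le> card (verts G)"
    using h assms(1) by (auto simp: legal_history_def intro: card_mono)
  ultimately show False by simp
qed

section \<open>The game on a complete bipartite graph\<close>

definition uncolored :: "'a history \<Rightarrow> 'a set \<Rightarrow> nat" where
  "uncolored h W = card (W - fst ` set h)"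

definition colors :: "'a history \<Rightarrow> 'a set \<Rightarrow> nat set" where
  "colors h W = {c. \<exists>v\<in>W. (v, c) \<in> set h}"

lemma uncolored_Nil [simp]: "uncolored [] W = card W"
  by (simp add: uncolored_def)

lemma colors_Nil [simp]: "colors [] W = {}"
  by (simp add: colors_def)

lemma uncolored_snoc:
  assumes "finite W" "v \<notin> fst ` set h"
  shows "uncolored (h @ [(v, c)]) W = (if v \<in> W then uncolored h W - 1 else uncolored h W)"
proof -
  have "W - fst ` set (h @ [(v, c)]) = (W - fst ` set h) - {v}" by auto
  then show ?thesis using assms by (simp add: uncolored_def)
qed

lemma uncolored_pos:
  "\<lbrakk>finite W; v \<in> W; v \<notin> fst ` set h\<rbrakk> \<Longrightarrow> 0 < uncolored h W"
  by (auto simp: uncolored_def card_gt_0_iff)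

lemma colors_snoc:
  "colors (h @ [(v, c)]) W = (if v \<in> W then insert c (colors h W) else colors h W)"
  by (auto simp: colors_def)

lemma uncolored_le: "finite W \<Longrightarrow> uncolored h W \<le> card W"
  by (simp add: uncolored_def card_mono)

lemma finite_colors [simp]: "finite (colors h W)"
  by (rule finite_subset[of _ "snd ` set h"]) (force simp: colors_def)+

lemma colors_subset: "legal_history G k h \<Longrightarrow> colors h W \<subseteq> {1..k}"
  by (force simp: colors_def legal_history_def)

text \<open>Legal colors lie in the palette, so counting them decides whether all of them
  occur.\<close>

lemma colors_eq_iff:
  assumes "legal_history G k h"
  shows "colors h W = {1..k} \<longleftrightarrow> k \<le> card (colors h W)"
  using card_seteq[OF _ colors_subset[OF assms], of W] by auto

text \<open>The sides are not ordered by size, so \<open>swap\<close> transfers every fact about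
  \<open>U\<close> to \<open>V\<close>.\<close>

locale bipartite_game =
  fixes G :: "('a, 'b) pre_digraph" and U V :: "'a set" and k :: nat
  assumes card_U: "2 \<le> card U" and card_V: "2 \<le> card V"
    and disjoint: "U \<inter> V = {}" and verts_eq: "verts G = U \<union> V"
    and arcs_eq: "arcs_ends G = U \<times> V \<union> V \<times> U"
    and k_pos: "1 \<le> k"
begin

lemma swap: "bipartite_game G V U k"
  using card_U card_V disjoint verts_eq arcs_eq k_pos by unfold_locales auto

lemma finite_U [simp]: "finite U" and finite_V [simp]: "finite V"
  using card_U card_V by (auto intro: card_ge_0_finite)

section \<open>End and outcome of the game in terms of the counts on the two sides\<close>

lemma complete_history_iff:
  assumes "legal_history G k h"
  shows "complete_history G h \<longleftrightarrow> uncolored h U = 0 \<and> uncolored h V = 0"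
  using assms unfolding complete_history_def uncolored_def legal_history_def
  by (auto simp: verts_eq)

lemma alice_winsI:
  assumes h: "legal_history G k h" and "k \<le> card (colors h U)" and "k \<le> card (colors h V)"
  shows "alice_wins G k h"
proof -
  have eq: "colors h U = {1..k}" "colors h V = {1..k}"
    using assms by (simp_all only: colors_eq_iff)
  show ?thesis
    unfolding alice_wins_def dominating_set_def
  proof (intro ballI conjI)
    fix c assume c: "c \<in> {1..k}"
    show "color_class h c \<subseteq> verts G"
      using h by (force simp: color_class_def legal_history_def)
    fix x assume x: "x \<in> verts G"
    obtain u v where "u \<in> U" "(u, c) \<in> set h" "v \<in> V" "(v, c) \<in> set h"
      using c eq unfolding colors_def by blast
    then show "closed_neighborhood G x \<inter> color_class h c \<noteq> {}"
      using x by (auto simp: closed_neighborhood_def color_class_def verts_eq arcs_eq)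
  qed
qed

text \<open>A vertex of \<open>V\<close> sees only itself and \<open>U\<close>, so a color missing
  on \<open>U\<close> must be the color of every vertex of \<open>V\<close>. This contradicts a
  second color on \<open>V\<close>; the case \<open>3 \<le> k\<close> needs a further look at
  \<open>U\<close>.\<close>

lemma not_alice_winsI:
  assumes h: "legal_history G k h" "complete_history G h"
    and U: "card (colors h U) < k" and V: "3 \<le> k \<or> 2 \<le> card (colors h V)"
  shows "\<not> alice_wins G k h"
proof
  assume win: "alice_wins G k h"
  have unique: "c = d" if "(v, c) \<in> set h" "(v, d) \<in> set h" for v c d
    using h that by (meson eq_key_imp_eq_value legal_history_def)
  have dom: "\<exists>y. y \<in> closed_neighborhood G x \<and> (y, c) \<in> set h"
    if "c \<in> {1..k}" "x \<in> U \<union> V" for c x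
  proof -
    have "closed_neighborhood G x \<inter> color_class h c \<noteq> {}"
      using win that by (simp add: alice_wins_def dominating_set_def verts_eq)
    then show ?thesis by (auto simp: color_class_def)
  qed
  have nbU: "closed_neighborhood G x = insert x V" if "x \<in> U" for x
    using that disjoint by (auto simp: closed_neighborhood_def arcs_eq)
  have nbV: "closed_neighborhood G x = insert x U" if "x \<in> V" for x
    using that disjoint by (auto simp: closed_neighborhood_def arcs_eq)
  have "\<not> {1..k} \<subseteq> colors h U"
    using U card_mono[of "colors h U" "{1..k}"] by auto
  then obtain c where c: "c \<in> {1..k}" "c \<notin> colors h U" by blast
  have Vc: "(v, c) \<in> set h" if "v \<in> V" for v
    using dom[of c v] c that nbV by (auto simp: colors_def)
  then have "colors h V \<subseteq> {c}"
    using unique by (auto simp: colors_def)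
  then have "card (colors h V) \<le> 1"
    using card_mono[of "{c}" "colors h V"] by simp
  then have "3 \<le> k" using V by simp
  then obtain a b where ab: "a \<in> {1..k}" "b \<in> {1..k}" "a \<noteq> b" "a \<noteq> c" "b \<noteq> c"
  proof -
    have "\<not> card ({1..k} - {c}) \<le> Suc 0" using \<open>3 \<le> k\<close> c by simp
    then obtain a b where "a \<in> {1..k} - {c}" "b \<in> {1..k} - {c}" "a \<noteq> b"
      by (meson card_le_Suc0_iff_eq finite_Diff finite_atLeastAtMost)
    then show ?thesis using that by blast
  qed
  obtain u where u: "u \<in> U" using card_U by fastforce
  \<comment> \<open>All of \<open>V\<close> has color \<open>c\<close>, so \<open>u\<close> must
    itself carry every other color, in particular both \<open>a\<close> and
    \<open>b\<close>.\<close>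
  have "(u, d) \<in> set h" if d: "d \<in> {1..k}" "d \<noteq> c" for d
  proof -
    obtain y where "y \<in> insert u V" "(y, d) \<in> set h"
      using dom[OF d(1), of u] u nbU by auto
    then show ?thesis using Vc[of y] unique[of y c d] d by auto
  qed
  then show False using ab unique by blast
qed

section \<open>Effect of single moves on the counts\<close>

lemma snoc_U:
  assumes "v \<in> U" "v \<notin> fst ` set h"
  shows "Suc (uncolored (h @ [(v, c)]) U) = uncolored h U"
    and "uncolored (h @ [(v, c)]) V = uncolored h V"
    and "colors (h @ [(v, c)]) U = insert c (colors h U)"
    and "colors (h @ [(v, c)]) V = colors h V"
proof -
  have "v \<notin> V" using assms disjoint by blast
  then show "Suc (uncolored (h @ [(v, c)]) U) = uncolored h U"
    and "uncolored (h @ [(v, c)]) V = uncolored h V"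
    and "colors (h @ [(v, c)]) U = insert c (colors h U)"
    and "colors (h @ [(v, c)]) V = colors h V"
    using assms uncolored_pos[OF finite_U assms]
    by (simp_all add: uncolored_snoc colors_snoc)
qed

lemma legal_move_U:
  assumes "legal_history G k h" "0 < uncolored h U" "c \<in> {1..k}"
  obtains v where "v \<in> U" "v \<notin> fst ` set h" "legal_history G k (h @ [(v, c)])"
proof -
  obtain v where "v \<in> U - fst ` set h"
    using assms(2) unfolding uncolored_def by (metis card.empty ex_in_conv less_irrefl)
  then show ?thesis
    using that[of v] assms by (auto simp: legal_history_snoc verts_eq)
qed

text \<open>Alice's basic move. Once the whole palette occurs on \<open>U\<close> any color will do,
  which is what \<open>min k\<close> accounts for.\<close>

lemma new_color_U:
  assumes "legal_history G k h" "0 < uncolored h U"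
  obtains y where "legal_history G k (h @ [y])"
    and "Suc (uncolored (h @ [y]) U) = uncolored h U" "uncolored (h @ [y]) V = uncolored h V"
    and "min k (Suc (card (colors h U))) \<le> card (colors (h @ [y]) U)"
    and "colors (h @ [y]) V = colors h V"
proof -
  obtain c where c: "c \<in> {1..k}" "min k (Suc (card (colors h U))) \<le> card (insert c (colors h U))"
  proof (cases "{1..k} \<subseteq> colors h U")
    case True
    then have "k \<le> card (insert 1 (colors h U))"
      using card_mono[of "insert 1 (colors h U)" "{1..k}"] by fastforce
    then show ?thesis using that[of 1] k_pos by simp
  next
    case False
    then obtain c where "c \<in> {1..k}" "c \<notin> colors h U" by blast
    then show ?thesis using that[of c] by simp
  qed
  obtain v where v: "v \<in> U" "v \<notin> fst ` set h" "legal_history G k (h @ [(v, c)])"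
    using legal_move_U[OF assms c(1)] .
  show ?thesis
    using that[OF v(3)] snoc_U[OF v(1,2), of c] c by simp
qed

text \<open>Bob's basic move. On a side without colors there is nothing to repeat, hence
  \<open>max 1\<close>.\<close>

lemma repeated_color_U:
  assumes "legal_history G k h" "0 < uncolored h U"
  obtains y where "legal_history G k (h @ [y])"
    and "Suc (uncolored (h @ [y]) U) = uncolored h U" "uncolored (h @ [y]) V = uncolored h V"
    and "card (colors (h @ [y]) U) \<le> max 1 (card (colors h U))"
    and "colors (h @ [y]) V = colors h V"
proof -
  obtain c where c: "c \<in> {1..k}" "card (insert c (colors h U)) \<le> max 1 (card (colors h U))"
  proof (cases "colors h U = {}")
    case True
    then show ?thesis using that[of 1] k_pos by simp
  next
    case False
    then obtain c where "c \<in> colors h U" by blast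
    moreover have "c \<in> {1..k}" using calculation colors_subset[OF assms(1)] by blast
    ultimately show ?thesis using that[of c] by (simp add: insert_absorb)
  qed
  obtain v where v: "v \<in> U" "v \<notin> fst ` set h" "legal_history G k (h @ [(v, c)])"
    using legal_move_U[OF assms c(1)] .
  show ?thesis
    using that[OF v(3)] snoc_U[OF v(1,2), of c] c by simp
qed

subsection \<open>Alice's strategy\<close>

text \<open>The last two conjuncts exclude that Bob, by filling one side, can force Alice to open the
  other one when she cannot afford to.\<close>

definition safe :: "'a history \<Rightarrow> bool" where
  "safe h \<longleftrightarrow>
    k \<le> card (colors h U) + uncolored h U div 2 + (if uncolored h U = card U then 1 else 0) \<and>
    k \<le> card (colors h V) + uncolored h V div 2 + (if uncolored h V = card V then 1 else 0) \<and>
    (uncolored h U = card U \<and> even (card U) \<and> card U < 2 * k \<longrightarrow> even (uncolored h V)) \<and>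
    (uncolored h V = card V \<and> even (card V) \<and> card V < 2 * k \<longrightarrow> even (uncolored h U))"

lemma safe_swap: "bipartite_game.safe V U k h \<longleftrightarrow> safe h"
  unfolding safe_def bipartite_game.safe_def[OF swap] by blast

text \<open>Alice replies with a new color on Bob's side while it has room. Accordingly
  \<open>safe\<close> credits each side with half of its uncolored vertices, and an untouched side
  with one more color for Bob's own opening move.\<close>

lemma safe_round_U:
  assumes legal: "legal_history G k (h @ [(v, c)])" and safe: "safe h" and v: "v \<in> U"
  shows "complete_history G (h @ [(v, c)]) \<and> alice_wins G k (h @ [(v, c)]) \<or>
    (\<exists>y. legal_history G k (h @ [(v, c), y]) \<and> safe (h @ [(v, c), y]))"
proof -
  let ?h = "h @ [(v, c)]"
  interpret swapped: bipartite_game G V U k by (rule swap)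
  have "v \<notin> fst ` set h" using legal by (simp add: legal_history_snoc)
  note bob = snoc_U[OF v this, of c]
  have h: "legal_history G k h" using legal by (rule legal_history_snocD)
  have leU: "uncolored h U \<le> card U" and leV: "uncolored h V \<le> card V"
    by (simp_all add: uncolored_le)
  have colors_mono: "card (colors h U) \<le> card (colors ?h U)" "1 \<le> card (colors ?h U)"
    unfolding bob by (auto intro: card_mono simp: Suc_le_eq card_gt_0_iff)
  \<comment> \<open>\<open>safe\<close> recognizes an untouched side by its count alone. Such a side
    has no colors, so the opening move there really adds one.\<close>
  have "uncolored h U = card U \<Longrightarrow> colors h U = {}"
    and "uncolored h V = card V \<Longrightarrow> colors h V = {}"
  proof -
    have *: "colors h W = {}" if "finite W" "uncolored h W = card W" for W :: "'a set"
    proof -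
      have "W - fst ` set h = W"
        using that by (intro card_subset_eq) (auto simp: uncolored_def)
      then show ?thesis by (force simp: colors_def)
    qed
    show "uncolored h U = card U \<Longrightarrow> colors h U = {}"
      and "uncolored h V = card V \<Longrightarrow> colors h V = {}"
      using * by auto
  qed
  then have fresh: "uncolored h U = card U \<Longrightarrow> card (colors h U) = 0"
    "uncolored h V = card V \<Longrightarrow> card (colors h V) = 0" by auto
  consider "0 < uncolored ?h U" | "uncolored ?h U = 0" "0 < uncolored ?h V"
    | "uncolored ?h U = 0" "uncolored ?h V = 0" by auto
  then show ?thesis
  proof cases
    case 1
    obtain y where y: "legal_history G k (?h @ [y])"
      "Suc (uncolored (?h @ [y]) U) = uncolored ?h U" "uncolored (?h @ [y]) V = uncolored ?h V"
      "min k (Suc (card (colors ?h U))) \<le> card (colors (?h @ [y]) U)"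
      "colors (?h @ [y]) V = colors ?h V"
      using new_color_U[OF legal 1] .
    have r: "uncolored h U = Suc (Suc (uncolored (?h @ [y]) U))" "uncolored (?h @ [y]) V = uncolored h V"
      "colors (?h @ [y]) V = colors h V"
      using y bob by simp_all
    have "safe (?h @ [y])"
      using safe colors_mono fresh leU y(4) unfolding safe_def r
      by (auto split: if_splits)
    then show ?thesis using y(1) by (intro disjI2 exI[of _ y]) simp
  next
    \<comment> \<open>Bob has just filled \<open>U\<close>, so Alice must move on \<open>V\<close>,
      possibly opening it.\<close>
    case 2
    obtain y where y: "legal_history G k (?h @ [y])"
      "Suc (uncolored (?h @ [y]) V) = uncolored ?h V" "uncolored (?h @ [y]) U = uncolored ?h U"
      "min k (Suc (card (colors ?h V))) \<le> card (colors (?h @ [y]) V)"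
      "colors (?h @ [y]) U = colors ?h U"
      using swapped.new_color_U[OF legal 2(2)] .
    have r: "uncolored h V = Suc (uncolored (?h @ [y]) V)" "uncolored (?h @ [y]) U = 0"
      "uncolored h U = 1" "colors (?h @ [y]) U = colors ?h U"
      using y bob 2 by simp_all
    have y4: "k \<le> card (colors (?h @ [y]) V) \<or>
        Suc (card (colors h V)) \<le> card (colors (?h @ [y]) V)"
      using y(4) bob by (simp add: min_def split: if_splits)
    have "k \<le> card (colors (?h @ [y]) V) + uncolored (?h @ [y]) V div 2"
    proof (cases "uncolored h V = card V")
      case True
      \<comment> \<open>Before Bob's move one vertex of \<open>U\<close> was uncolored, an odd
        number, so the last conjunct of \<open>safe\<close> leaves only an odd side \<open>V\<close>
        or one with at least \<open>2 * k\<close> vertices. In both cases Alice can afford to open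
        it.\<close>
      then have "odd (uncolored h V) \<or> 2 * k \<le> uncolored h V" "k \<le> uncolored h V div 2 + 1"
        using safe r(3) fresh unfolding safe_def by auto
      then show ?thesis using y4 r(1) by (auto elim!: oddE)
    next
      case False
      then have "k \<le> card (colors h V) + uncolored h V div 2"
        using safe unfolding safe_def by simp
      then show ?thesis using y4 r(1) by auto
    qed
    \<comment> \<open>The single vertex left before Bob's move counts nothing after halving, and
      \<open>U\<close> was not untouched, so all colors already occurred there.\<close>
    moreover have "k \<le> card (colors (?h @ [y]) U)"
      using safe colors_mono card_U unfolding safe_def r by simp
    \<comment> \<open>Both sides are now touched, which makes the parity conjuncts vacuous.\<close>
    moreover have "uncolored (?h @ [y]) V \<noteq> card V" "uncolored (?h @ [y]) U \<noteq> card U"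
      using r leV card_U by auto
    ultimately have "safe (?h @ [y])" by (simp add: safe_def)
    then show ?thesis using y(1) by (intro disjI2 exI[of _ y]) simp
  next
    case 3
    have r: "uncolored h U = 1" "uncolored h V = 0" using 3 bob by simp_all
    have "card U \<noteq> 1" "card V \<noteq> 0" using card_U card_V by auto
    then have "k \<le> card (colors h U)" "k \<le> card (colors h V)"
      using safe unfolding safe_def r by simp_all
    then have "alice_wins G k ?h"
      using alice_winsI[OF legal] colors_mono(1) bob(4) by simp
    then show ?thesis using complete_history_iff[OF legal] 3 by simp
  qed
qed

lemma safe_round:
  assumes "legal_history G k (h @ [x])" "safe h"
  shows "complete_history G (h @ [x]) \<and> alice_wins G k (h @ [x]) \<or>
    (\<exists>y. legal_history G k (h @ [x, y]) \<and> safe (h @ [x, y]))"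
proof -
  interpret swapped: bipartite_game G V U k by (rule swap)
  obtain v c where x: "x = (v, c)" by (cases x)
  have "v \<in> U \<or> v \<in> V"
    using assms(1) x by (auto simp: legal_history_snoc verts_eq)
  then show ?thesis
    using assms x safe_round_U[of h v c] swapped.safe_round_U[of h v c]
    by (auto simp: safe_swap)
qed

lemma winning_strategy_if_safe:
  assumes "if p = Alice then \<exists>x. legal_history G k [x] \<and> safe [x] else safe []"
  shows "\<exists>\<sigma>. winning_strategy G k p \<sigma>"
proof -
  have final: "alice_wins G k h"
    if "legal_history G k h" "complete_history G h" "safe h" for h
  proof (rule alice_winsI[OF that(1)])
    have "uncolored h U = 0" "uncolored h V = 0"
      using that complete_history_iff by auto
    moreover have "card U \<noteq> 0" "card V \<noteq> 0" using card_U card_V by auto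
    ultimately show "k \<le> card (colors h U)" "k \<le> card (colors h V)"
      using that(3) unfolding safe_def by simp_all
  qed
  obtain P where "can_maintain G k p Alice P"
    "\<And>h. \<lbrakk>legal_history G k h; complete_history G h; P h\<rbrakk> \<Longrightarrow> alice_wins G k h"
    using can_maintainI[of p Alice G k safe "alice_wins G k"] assms safe_round final by blast
  then show ?thesis using winning_strategyI[OF k_pos] by blast
qed

text \<open>The assumptions are the four conjuncts of \<open>safe\<close> at the empty
  history.\<close>

lemma alice_wins_second:
  assumes "k \<le> card U div 2 + 1" "k \<le> card V div 2 + 1"
    and "even (card U) \<and> card U < 2 * k \<longrightarrow> even (card V)"
    and "even (card V) \<and> card V < 2 * k \<longrightarrow> even (card U)"
  shows "\<exists>\<sigma>. winning_strategy G k Bob \<sigma>"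
  using assms by (intro winning_strategy_if_safe) (simp add: safe_def)

text \<open>Alice opens \<open>U\<close> herself and so forgoes Bob's bonus color there. The
  untouched side \<open>V\<close> then faces \<open>card U - 1\<close> uncolored vertices, which
  reverses the parity condition.\<close>

lemma alice_wins_first:
  assumes "k \<le> (card U - 1) div 2 + 1" "k \<le> card V div 2 + 1"
    and "even (card V) \<and> card V < 2 * k \<longrightarrow> odd (card U)"
  shows "\<exists>\<sigma>. winning_strategy G k Alice \<sigma>"
proof (intro winning_strategy_if_safe)
  have "0 < uncolored [] U" using card_U by simp
  then obtain v where v: "v \<in> U" "v \<notin> fst ` set ([] :: 'a history)" "legal_history G k ([] @ [(v, 1)])"
    using legal_move_U[of "[]" 1] k_pos by auto
  note r = snoc_U[OF v(1,2), of 1, unfolded append_Nil uncolored_Nil colors_Nil]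
  have "uncolored [(v, 1)] U = card U - 1" "uncolored [(v, 1)] U \<noteq> card U"
    using r(1) by auto
  then have "safe [(v, 1)]"
    using assms card_U r unfolding safe_def by auto
  then show "if Alice = Alice then \<exists>x. legal_history G k [x] \<and> safe [x] else safe []"
    using v(3) by auto
qed

subsection \<open>Bob's strategies\<close>

lemma no_winning_strategyI:
  assumes init: "if p = Bob then \<exists>x. legal_history G k [x] \<and> I [x] else I []"
    and round: "\<And>h x. \<lbrakk>legal_history G k (h @ [x]); I h\<rbrakk> \<Longrightarrow>
      complete_history G (h @ [x]) \<and> \<not> alice_wins G k (h @ [x]) \<or>
      (\<exists>y. legal_history G k (h @ [x, y]) \<and> I (h @ [x, y]))"
    and final: "\<And>h. \<lbrakk>legal_history G k h; complete_history G h; I h\<rbrakk> \<Longrightarrow> \<not> alice_wins G k h"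
  shows "\<not> winning_strategy G k p \<sigma>"
proof -
  obtain P where "can_maintain G k p Bob P"
    "\<And>h. \<lbrakk>legal_history G k h; complete_history G h; P h\<rbrakk> \<Longrightarrow> \<not> alice_wins G k h"
    using can_maintainI[of p Bob G k I "\<lambda>h. \<not> alice_wins G k h"] assms by blast
  then show ?thesis using not_winning_strategyI[of G k p P] by (simp add: verts_eq)
qed

text \<open>By repeating colors on \<open>U\<close> as long as it has room, Bob leaves Alice at most
  every other vertex there for a new color.\<close>

lemma bob_wins_repeating:
  assumes k: "card U div 2 + 2 \<le> k"
  shows "\<not> winning_strategy G k p \<sigma>"
proof (rule no_winning_strategyI)
  \<comment> \<open>Half is rounded up because Alice is to move; after her move the bound holds with
    half rounded down.\<close>
  let ?I = "\<lambda>h. card (colors h U) + (uncolored h U + 1) div 2 < k"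
  interpret swapped: bipartite_game G V U k by (rule swap)
  have k3: "3 \<le> k" using k card_U by simp
  have lost: "\<not> alice_wins G k h"
    if "legal_history G k h" "complete_history G h" "card (colors h U) < k" for h
    using not_alice_winsI[OF that] k3 by blast
  show "\<not> alice_wins G k h" if "legal_history G k h" "complete_history G h" "?I h" for h
    using lost that by simp
  show "if p = Bob then \<exists>x. legal_history G k [x] \<and> ?I [x] else ?I []"
  proof (cases "p = Bob")
    case True
    have "0 < uncolored [] U" using card_U by simp
    then obtain y where "legal_history G k ([] @ [y])" "Suc (uncolored ([] @ [y]) U) = uncolored [] U"
      "card (colors ([] @ [y]) U) \<le> max 1 (card (colors [] U))"
      using repeated_color_U[of "[]"] by (metis legal_history_Nil)
    then have "legal_history G k [y] \<and> ?I [y]" using k by auto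
    then show ?thesis using True by metis
  next
    case False
    then show ?thesis using k by auto
  qed
  show "complete_history G (h @ [x]) \<and> \<not> alice_wins G k (h @ [x]) \<or>
      (\<exists>y. legal_history G k (h @ [x, y]) \<and> ?I (h @ [x, y]))"
    if legal: "legal_history G k (h @ [x])" and I: "?I h" for h x
  proof -
    let ?h = "h @ [x]"
    obtain v c where x: "x = (v, c)" by (cases x)
    have v: "v \<in> U \<or> v \<in> V" "v \<notin> fst ` set h"
      using legal x by (auto simp: legal_history_snoc verts_eq)
    have alice: "card (colors ?h U) + uncolored ?h U div 2 < k"
    proof (cases "v \<in> U")
      case True
      have "card (colors ?h U) \<le> Suc (card (colors h U))"
        using snoc_U(3)[OF True v(2), of c] x by (simp add: card_insert_if)
      then show ?thesis using snoc_U(1)[OF True v(2), of c] x I by auto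
    next
      case False
      then have "v \<in> V" using v by blast
      then show ?thesis
        using swapped.snoc_U(2,4)[OF _ v(2), of c] x I by auto
    qed
    have le: "uncolored ?h U \<le> card U" by (simp add: uncolored_le)
    consider "0 < uncolored ?h U" | "uncolored ?h U = 0" "0 < uncolored ?h V"
      | "uncolored ?h U = 0" "uncolored ?h V = 0" by auto
    then show ?thesis
    proof cases
      case 1
      obtain y where y: "legal_history G k (?h @ [y])"
        "Suc (uncolored (?h @ [y]) U) = uncolored ?h U"
        "card (colors (?h @ [y]) U) \<le> max 1 (card (colors ?h U))"
        using repeated_color_U[OF legal 1] .
      \<comment> \<open>Needed when \<open>U\<close> has no color yet: Bob's move then introduces
        one, and the lower bound on \<open>k\<close> pays for it.\<close>
      have "uncolored ?h U div 2 \<le> card U div 2" using le by (rule div_le_mono)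
      then have "?I (?h @ [y])"
        using y(2,3) alice k by (auto simp: max_def split: if_splits)
      then show ?thesis using y(1) by (intro disjI2 exI[of _ y]) simp
    next
      case 2
      obtain y where y: "legal_history G k (?h @ [y])"
        "uncolored (?h @ [y]) U = uncolored ?h U" "colors (?h @ [y]) U = colors ?h U"
        using swapped.repeated_color_U[OF legal 2(2)] .
      then have "legal_history G k (?h @ [y]) \<and> ?I (?h @ [y])" using y alice 2 by simp
      then show ?thesis by (intro disjI2 exI[of _ y]) simp
    next
      case 3
      then have "complete_history G ?h" using complete_history_iff[OF legal] by simp
      then show ?thesis using lost[OF legal] alice by simp
    qed
  qed
qed

text \<open>Bob answers on the side that Alice has just played. Making the other side bichromatic is only
  needed for \<open>k = 2\<close>, where Alice also wins with two monochromatic sides of different colors.\<close>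

lemma bob_wins_pairing:
  assumes "even (card U)" and parity: "even (card V) \<longleftrightarrow> p = Alice"
    and k: "card U div 2 + 1 \<le> k"
  shows "\<not> winning_strategy G k p \<sigma>"
proof (rule no_winning_strategyI)
  \<comment> \<open>Evenness guarantees a reply on the same side, and each pair of moves on
    \<open>U\<close> brings at most one new color. The bound \<open>card V - 1\<close> exempts a
    lone opening move of Bob on \<open>V\<close>.\<close>
  let ?I = "\<lambda>h. even (uncolored h U) \<and> even (uncolored h V) \<and>
    2 * card (colors h U) + uncolored h U \<le> card U \<and>
    (uncolored h V < card V - 1 \<longrightarrow> 2 \<le> card (colors h V))"
  interpret swapped: bipartite_game G V U k by (rule swap)
  have k2: "2 \<le> k" using k card_U by simp
  show "\<not> alice_wins G k h" if "legal_history G k h" "complete_history G h" "?I h" for h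
  proof (rule not_alice_winsI[OF that(1,2)])
    have "uncolored h U = 0" "uncolored h V = 0"
      using that complete_history_iff by auto
    then show "card (colors h U) < k" "3 \<le> k \<or> 2 \<le> card (colors h V)"
      using that(3) k card_V by auto
  qed
  show "if p = Bob then \<exists>x. legal_history G k [x] \<and> ?I [x] else ?I []"
  proof (cases "p = Bob")
    case True
    \<comment> \<open>Here \<open>V\<close> is odd. Bob spends one vertex of it, leaving an even
      number on both sides; the color is irrelevant.\<close>
    have "0 < uncolored [] V" using card_V by simp
    then obtain y where "legal_history G k ([] @ [y])"
      "Suc (uncolored ([] @ [y]) V) = uncolored [] V" "uncolored ([] @ [y]) U = uncolored [] U"
      "colors ([] @ [y]) U = colors [] U"
      using swapped.repeated_color_U[of "[]"] by (metis legal_history_Nil)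
    moreover from this have "uncolored [y] V = card V - 1" by simp
    ultimately have "legal_history G k [y] \<and> ?I [y]" using True assms by auto
    then show ?thesis using True by metis
  next
    case False
    then have "p = Alice" using player.exhaust by blast
    then show ?thesis using assms by auto
  qed
  show "complete_history G (h @ [x]) \<and> \<not> alice_wins G k (h @ [x]) \<or>
      (\<exists>y. legal_history G k (h @ [x, y]) \<and> ?I (h @ [x, y]))"
    if legal: "legal_history G k (h @ [x])" and I: "?I h" for h x
  proof -
    let ?h = "h @ [x]"
    obtain v c where x: "x = (v, c)" by (cases x)
    have v: "v \<in> U \<or> v \<in> V" "v \<notin> fst ` set h" "c \<in> {1..k}"
      using legal x by (auto simp: legal_history_snoc verts_eq)
    have "\<exists>y. legal_history G k (?h @ [y]) \<and> ?I (?h @ [y])"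
    proof (cases "v \<in> U")
      case True
      note alice = snoc_U[OF True v(2), of c, folded x]
      have "odd (uncolored ?h U)" using alice(1) I by (metis even_Suc)
      then have "0 < uncolored ?h U" by (rule odd_pos)
      then obtain y where y: "legal_history G k (?h @ [y])"
        "Suc (uncolored (?h @ [y]) U) = uncolored ?h U" "uncolored (?h @ [y]) V = uncolored ?h V"
        "card (colors (?h @ [y]) U) \<le> max 1 (card (colors ?h U))"
        "colors (?h @ [y]) V = colors ?h V"
        using repeated_color_U[OF legal] by blast
      have "1 \<le> card (colors ?h U)" "card (colors ?h U) \<le> Suc (card (colors h U))"
        unfolding alice by (auto simp: card_insert_if Suc_le_eq card_gt_0_iff)
      then have "card (colors (?h @ [y]) U) \<le> Suc (card (colors h U))" using y(4) by simp
      moreover have "uncolored h U = Suc (Suc (uncolored (?h @ [y]) U))" using alice y by simp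
      ultimately have "?I (?h @ [y])" using I y(3,5) alice by auto
      then show ?thesis using y(1) by blast
    next
      case False
      then have "v \<in> V" using v by blast
      note alice = swapped.snoc_U[OF this v(2), of c, folded x]
      have "odd (uncolored ?h V)" using alice(1) I by (metis even_Suc)
      then have pos: "0 < uncolored ?h V" by (rule odd_pos)
      \<comment> \<open>Any color other than Alice's makes \<open>V\<close> bichromatic.\<close>
      define d where "d = (if c = 1 then 2 else 1 :: nat)"
      have d: "d \<in> {1..k}" "d \<noteq> c" using k2 by (auto simp: d_def)
      obtain w where w: "w \<in> V" "w \<notin> fst ` set ?h" "legal_history G k (?h @ [(w, d)])"
        using swapped.legal_move_U[OF legal pos d(1)] .
      note bob = swapped.snoc_U[OF w(1,2), of d]
      have "card {c, d} \<le> card (colors (?h @ [(w, d)]) V)"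
        unfolding bob alice by (intro card_mono) auto
      then have "2 \<le> card (colors (?h @ [(w, d)]) V)" using d by simp
      moreover have "uncolored h V = Suc (Suc (uncolored (?h @ [(w, d)]) V))"
        using alice bob by simp
      ultimately have "?I (?h @ [(w, d)])" using I bob alice by auto
      then show ?thesis using w(3) by blast
    qed
    then show ?thesis by simp
  qed
qed

end

section \<open>The game domatic numbers\<close>

lemma Greatest_winning_eq:
  fixes t :: nat
  assumes "1 \<le> t" "\<exists>\<sigma>. winning_strategy G t p \<sigma>"
    and "\<And>k \<sigma>. t < k \<Longrightarrow> \<not> winning_strategy G k p \<sigma>"
  shows "(GREATEST k. 1 \<le> k \<and> (\<exists>\<sigma>. winning_strategy G k p \<sigma>)) = t"
  using assms by (intro Greatest_equality) (auto simp: not_less[symmetric])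

theorem theorem5p5:
  fixes m n :: nat and G :: "('a, 'b) pre_digraph"
  assumes "2 \<le> m" and "m \<le> n"
    and "complete_bipartite_digraph m n G"
  shows "real (game_domatic_number G) =
           (if even m \<and> even n then real m / 2 else real_of_int \<lceil>(real m + 1) / 2\<rceil>)
       \<and> real (delayed_game_domatic_number G) =
           (if even m \<and> odd n then real m / 2 else real_of_int \<lceil>(real m + 1) / 2\<rceil>)"
proof -
  obtain U V where UV: "verts G = U \<union> V" "U \<inter> V = {}" "card U = m" "card V = n"
      "arcs_ends G = U \<times> V \<union> V \<times> U"
    using assms(3) unfolding complete_bipartite_digraph_def by blast
  have game: "bipartite_game G U V k" if "1 \<le> k" for k
    using UV assms that by unfold_locales auto
  have ceiling: "\<lceil>(real m + 1) / 2\<rceil> = int (m div 2 + 1)"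
    by (cases "even m") (auto simp: ceiling_unique elim!: evenE oddE)
  define s where "s = (if even m \<and> even n then m div 2 else m div 2 + 1)"
  have "game_domatic_number G = s"
    unfolding game_domatic_number_def
  proof (rule Greatest_winning_eq)
    show "1 \<le> s" using assms by (auto simp: s_def)
    then interpret bipartite_game G U V s by (rule game)
    interpret swapped: bipartite_game G V U s by (rule swap)
    show "\<exists>\<sigma>. winning_strategy G s Alice \<sigma>"
    \<comment> \<open>In this case Alice opens the larger side: an even number remains there, and
      the smaller side keeps its bonus. Otherwise she opens the smaller side.\<close>
    proof (cases "even m \<and> odd n")
      case True
      then show ?thesis
        using assms UV by (intro swapped.alice_wins_first) (auto simp: s_def elim!: evenE oddE)
    next
      case False
      then show ?thesis
        using assms UV by (intro alice_wins_first) (auto simp: s_def elim!: evenE oddE)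
    qed
  next
    fix k \<sigma> assume k: "s < k"
    then interpret bipartite_game G U V k by (intro game) simp
    \<comment> \<open>Pairing is for even \<open>m\<close> and \<open>n\<close>; in all other cases
      repeating suffices.\<close>
    show "\<not> winning_strategy G k Alice \<sigma>"
      using k UV bob_wins_pairing[of Alice \<sigma>] bob_wins_repeating[of Alice \<sigma>]
      by (auto simp: s_def split: if_splits)
  qed
  moreover define t where "t = (if even m \<and> odd n then m div 2 else m div 2 + 1)"
  have "delayed_game_domatic_number G = t"
    unfolding delayed_game_domatic_number_def
  proof (rule Greatest_winning_eq)
    show "1 \<le> t" using assms by (auto simp: t_def)
    then interpret bipartite_game G U V t by (rule game)
    show "\<exists>\<sigma>. winning_strategy G t Bob \<sigma>"
      \<comment> \<open>If \<open>m\<close> is odd, an even \<open>n\<close> is at least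
        \<open>m + 1 = 2 * t\<close>; if \<open>m\<close> is even and \<open>n\<close> odd, then
        \<open>m = 2 * t\<close>. So no parity condition is violated.\<close>
      using assms UV
      by (intro alice_wins_second) (auto simp: t_def div_le_mono split: if_splits, presburger+)
  next
    fix k \<sigma> assume k: "t < k"
    then interpret bipartite_game G U V k by (intro game) simp
    show "\<not> winning_strategy G k Bob \<sigma>"
      using k UV bob_wins_pairing[of Bob \<sigma>] bob_wins_repeating[of Bob \<sigma>]
      by (auto simp: t_def split: if_splits)
  qed
  ultimately show ?thesis
    by (auto simp: s_def t_def ceiling real_of_nat_div)
qed

end
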